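(* For any given fair division instance $\mathcal{I}=\langle [n],[m],\{v_i\}_{i=1}^n \rangle$ with range parameter $\gamma \in (0,1]$, one can compute a $\frac{5}{6}\gamma$-PMMS allocation in polynomial time.
   Context: A fair division instance $\langle [n],[m],\{v_i\}_{i=1}^n\rangle$ consists of agents $[n]=\{1,\dots,n\}$, indivisible goods $[m]=\{1,\dots,m\}$, and additive valuations $v_i:2^{[m]}\to\mathbb{R}_{\ge 0}$, i.e. $v_i(S)=\sum_{g\in S}v_i(g)$. Throughout, every agent positively values at least one good, and every good has positive value for at least one agent. For a good $g$, $\gamma_g=\frac{\min_{j:v_j(g)>0}v_j(g)}{\max_i v_i(g)}$; the range parameter of the instance is $\gamma=\min_{g\in[m]}\gamma_g$. An allocation $\mathcal{A}=(A_1,\dots,A_n)$ is a tuple of pairwise disjoint subsets of $[m]$ with $\bigcup_i A_i=[m]$. For an agent $i$ and $S\subseteq[m]$, the 1-out-of-2 maximin share is $\mu_i^{(2)}(S)=\max_{X\subseteq S}\min\{v_i(X),v_i(S\setminus X)\}$. For $\alpha\in(0,1)$, $\mathcal{A}$ is $\alpha$-PMMS if $v_i(A_i)\ge\alpha\,\mu_i^{(2)}(A_i\cup A_j)$ for every pair of agents $i\ne j$. *)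

theory Defs
  imports Complex_Main "HOL-Library.Disjoint_Sets" "HOL-Computational_Algebra.Polynomial"
begin

text \<open>
  Agents are \<open>{1..n}\<close>, goods are \<open>{1..m}\<close>, and a valuation profile is
  \<open>v :: nat \<Rightarrow> nat set \<Rightarrow> real\<close>; the value of a single good \<open>g\<close> for agent \<open>i\<close> is \<open>v i {g}\<close>.
  Values of \<open>v\<close> outside these ranges are irrelevant.
  The condition \<open>n \<ge> 1\<close> is the usual implicit one; \<open>m \<ge> 1\<close> then follows.
\<close>

definition fair_division_instance :: "nat \<Rightarrow> nat \<Rightarrow> (nat \<Rightarrow> nat set \<Rightarrow> real) \<Rightarrow> bool" where
  "fair_division_instance n m v \<longleftrightarrow>
     n \<ge> 1 \<and>
     (\<forall>i\<in>{1..n}. \<forall>S. S \<subseteq> {1..m} \<longrightarrow> v i S \<ge> 0 \<and> v i S = (\<Sum>g\<in>S. v i {g})) \<and>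
     (\<forall>i\<in>{1..n}. \<exists>g\<in>{1..m}. v i {g} > 0) \<and>
     (\<forall>g\<in>{1..m}. \<exists>i\<in>{1..n}. v i {g} > 0)"

definition good_range :: "nat \<Rightarrow> (nat \<Rightarrow> nat set \<Rightarrow> real) \<Rightarrow> nat \<Rightarrow> real" where
  "good_range n v g =
     Min {v j {g} | j. j \<in> {1..n} \<and> v j {g} > 0} / Max {v i {g} | i. i \<in> {1..n}}"

definition range_parameter :: "nat \<Rightarrow> nat \<Rightarrow> (nat \<Rightarrow> nat set \<Rightarrow> real) \<Rightarrow> real" where
  "range_parameter n m v = Min (good_range n v ` {1..m})"

definition allocation :: "nat \<Rightarrow> nat \<Rightarrow> (nat \<Rightarrow> nat set) \<Rightarrow> bool" where
  "allocation n m A \<longleftrightarrow> disjoint_family_on A {1..n} \<and> (\<Union>i\<in>{1..n}. A i) = {1..m}"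

definition mms2 :: "(nat set \<Rightarrow> real) \<Rightarrow> nat set \<Rightarrow> real" where
  "mms2 u S = Max {min (u X) (u (S - X)) | X. X \<subseteq> S}"

definition PMMS :: "real \<Rightarrow> nat \<Rightarrow> (nat \<Rightarrow> nat set \<Rightarrow> real) \<Rightarrow> (nat \<Rightarrow> nat set) \<Rightarrow> bool" where
  "PMMS \<alpha> n v A \<longleftrightarrow>
     (\<forall>i\<in>{1..n}. \<forall>j\<in>{1..n}. i \<noteq> j \<longrightarrow> v i (A i) \<ge> \<alpha> * mms2 (v i) (A i \<union> A j))"

lemma range_parameter_bounds:
  assumes "fair_division_instance n m v"
  shows "0 < range_parameter n m v" "range_parameter n m v \<le> 1"
proof -
  have n: "n \<ge> 1" and agents: "\<forall>i\<in>{1..n}. \<exists>g\<in>{1..m}. v i {g} > 0"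
    and goods: "\<forall>g\<in>{1..m}. \<exists>i\<in>{1..n}. v i {g} > 0"
    using assms unfolding fair_division_instance_def by blast+
  have ne: "{1..m} \<noteq> {}" using n agents by force
  have *: "0 < good_range n v g \<and> good_range n v g \<le> 1" if g: "g \<in> {1..m}" for g
  proof -
    define P where "P = {v j {g} | j. j \<in> {1..n} \<and> v j {g} > 0}"
    define M where "M = {v i {g} | i. i \<in> {1..n}}"
    have fin: "finite P" "finite M" unfolding P_def M_def by simp_all
    obtain i where i: "i \<in> {1..n}" "v i {g} > 0" using goods g by blast
    have mem: "v i {g} \<in> P" "v i {g} \<in> M" unfolding P_def M_def using i by blast+
    have le: "Min P \<le> v i {g}" "v i {g} \<le> Max M"
      using fin mem by (blast intro: Min_le Max_ge)+
    have "Min P \<in> P" using fin(1) mem(1) by (blast intro: Min_in)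
    moreover have "\<forall>x\<in>P. x > 0" unfolding P_def by blast
    ultimately have pos: "Min P > 0" by blast
    have "good_range n v g = Min P / Max M" unfolding good_range_def P_def M_def by (rule refl)
    moreover have "0 < Min P / Max M" "Min P / Max M \<le> 1"
      using le pos by (auto simp: divide_le_eq_1)
    ultimately show ?thesis by simp
  qed
  have "range_parameter n m v \<in> good_range n v ` {1..m}"
    unfolding range_parameter_def by (rule Min_in) (simp, use ne in blast)
  then obtain g where "g \<in> {1..m}" "range_parameter n m v = good_range n v g" by blast
  then show "0 < range_parameter n m v" "range_parameter n m v \<le> 1" using * by metis+
qed

text \<open>
  Since valuations are real, running time is measured on a real random access machine: a
  program works on named arrays of naturals (which also serve as addresses) and named arrays
  of reals, and every elementary command or test costs one time unit. A program is a fixed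
  finite text, so every expression in it performs a bounded number of operations.
  Arithmetic is restricted to addition, subtraction and comparison, and constants to natural
  numbers. Hence \<open>t\<close> steps lengthen the binary representation of a number by at most \<open>O(t)\<close>
  bits, and on rational inputs a polynomial bound on the number of steps is also one in the
  Turing machine model; unit-cost multiplication would destroy this.
\<close>

type_synonym vname = string
type_synonym state = "(vname \<Rightarrow> nat \<Rightarrow> nat) \<times> (vname \<Rightarrow> nat \<Rightarrow> real)"

datatype nexp = NConst nat | NCell vname nexp | NAdd nexp nexp | NSub nexp nexp

datatype rexp = RConst nat | RCell vname nexp | RAdd rexp rexp | RSub rexp rexp

datatype bexp = NLess nexp nexp | RLess rexp rexp | BNot bexp | BAnd bexp bexp

datatype com =
    Skip
  | NAssign vname nexp nexp
  | RAssign vname nexp rexp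
  | Seq com com
  | Cond bexp com com
  | While bexp com

fun nval :: "nexp \<Rightarrow> state \<Rightarrow> nat" where
  "nval (NConst k) s = k"
| "nval (NCell x e) s = fst s x (nval e s)"
| "nval (NAdd e f) s = nval e s + nval f s"
| "nval (NSub e f) s = nval e s - nval f s"

fun rval :: "rexp \<Rightarrow> state \<Rightarrow> real" where
  "rval (RConst k) s = real k"
| "rval (RCell x e) s = snd s x (nval e s)"
| "rval (RAdd e f) s = rval e s + rval f s"
| "rval (RSub e f) s = rval e s - rval f s"

fun bval :: "bexp \<Rightarrow> state \<Rightarrow> bool" where
  "bval (NLess e f) s = (nval e s < nval f s)"
| "bval (RLess e f) s = (rval e s < rval f s)"
| "bval (BNot b) s = (\<not> bval b s)"
| "bval (BAnd b c) s = (bval b s \<and> bval c s)"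

definition upd :: "(vname \<Rightarrow> nat \<Rightarrow> 'a) \<Rightarrow> vname \<Rightarrow> nat \<Rightarrow> 'a \<Rightarrow> vname \<Rightarrow> nat \<Rightarrow> 'a" where
  "upd \<sigma> x k a = \<sigma>(x := (\<sigma> x)(k := a))"

text \<open>\<open>exec c s t s'\<close>: started in \<open>s\<close>, the program \<open>c\<close> halts after \<open>t\<close> steps in \<open>s'\<close>.\<close>

inductive exec :: "com \<Rightarrow> state \<Rightarrow> nat \<Rightarrow> state \<Rightarrow> bool" where
  Skip: "exec Skip s 1 s"
| NAssign: "exec (NAssign x e f) s 1 (upd (fst s) x (nval e s) (nval f s), snd s)"
| RAssign: "exec (RAssign x e f) s 1 (fst s, upd (snd s) x (nval e s) (rval f s))"
| Seq: "exec c s t s' \<Longrightarrow> exec d s' t' s'' \<Longrightarrow> exec (Seq c d) s (t + t') s''"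
| CondTrue: "bval b s \<Longrightarrow> exec c s t s' \<Longrightarrow> exec (Cond b c d) s (1 + t) s'"
| CondFalse: "\<not> bval b s \<Longrightarrow> exec d s t s' \<Longrightarrow> exec (Cond b c d) s (1 + t) s'"
| WhileFalse: "\<not> bval b s \<Longrightarrow> exec (While b c) s 1 s"
| WhileTrue: "bval b s \<Longrightarrow> exec c s t s' \<Longrightarrow> exec (While b c) s' t' s'' \<Longrightarrow>
    exec (While b c) s (1 + t + t') s''"

text \<open>
  By determinism, the existence of one halting execution with a given property describes the
  behaviour of the program completely.
\<close>

lemma exec_deterministic:
  "exec c s t s' \<Longrightarrow> exec c s u s'' \<Longrightarrow> t = u \<and> s' = s''"
proof (induction arbitrary: u s'' rule: exec.induct)
  case (Skip s)
  then show ?case by cases auto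
next
  case (NAssign x e f s)
  then show ?case by cases auto
next
  case (RAssign x e f s)
  then show ?case by cases auto
next
  case (Seq c s t s' d t' s2)
  from Seq.prems show ?case by cases (metis Seq.IH)
next
  case (CondTrue b s c t s' d)
  from CondTrue.prems show ?case by cases (use CondTrue.hyps CondTrue.IH in blast)+
next
  case (CondFalse b s d t s' c)
  from CondFalse.prems show ?case by cases (use CondFalse.hyps CondFalse.IH in blast)+
next
  case (WhileFalse b s c)
  from WhileFalse.prems show ?case by cases (use WhileFalse.hyps in auto)
next
  case (WhileTrue b s c t s' t' s2)
  from WhileTrue.prems show ?case
    by cases (use WhileTrue.hyps(1) in blast, metis WhileTrue.IH)
qed

text \<open>
  The input consists of \<open>n\<close> and \<open>m\<close> and the \<open>n \<times> m\<close> matrix of the values \<open>v i {g}\<close> in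
  row-major order, that is, \<open>v i {g}\<close> is stored at address \<open>(i - 1) * m + (g - 1)\<close>;
  all other cells are initially zero.
\<close>

definition input_state :: "nat \<Rightarrow> nat \<Rightarrow> (nat \<Rightarrow> nat set \<Rightarrow> real) \<Rightarrow> state" where
  "input_state n m v =
     (\<lambda>x k. if x = ''n'' \<and> k = 0 then n else if x = ''m'' \<and> k = 0 then m else 0,
      \<lambda>x k. if x = ''v'' \<and> k < n * m then v (k div m + 1) {k mod m + 1} else 0)"

definition input_size :: "nat \<Rightarrow> nat \<Rightarrow> nat" where
  "input_size n m = n * m + 2"

text \<open>The output is read off the array \<open>''owner''\<close>, which names the recipient of every good.\<close>

definition output_allocation :: "nat \<Rightarrow> state \<Rightarrow> nat \<Rightarrow> nat set" where
  "output_allocation m s i = {g \<in> {1..m}. fst s ''owner'' g = i}"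

text \<open>
  \<open>Sol n m v A\<close> says that \<open>A\<close> is an acceptable answer on the instance. One and the same program
  and polynomial have to work for all instances.
\<close>

definition poly_time_computable ::
  "(nat \<Rightarrow> nat \<Rightarrow> (nat \<Rightarrow> nat set \<Rightarrow> real) \<Rightarrow> bool) \<Rightarrow>
   (nat \<Rightarrow> nat \<Rightarrow> (nat \<Rightarrow> nat set \<Rightarrow> real) \<Rightarrow> (nat \<Rightarrow> nat set) \<Rightarrow> bool) \<Rightarrow> bool" where
  "poly_time_computable Inst Sol \<longleftrightarrow>
     (\<exists>(c :: com) (p :: nat poly). \<forall>n m v. Inst n m v \<longrightarrow>
        (\<exists>t s. exec c (input_state n m v) t s \<and> t \<le> poly p (input_size n m) \<and>
               Sol n m v (output_allocation m s)))"

end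

theory Submission
  imports Defs
begin

text \<open>
  Let \<open>w g\<close> be the largest value any agent has for \<open>g\<close>. An agent who values \<open>g\<close> at all values it
  between \<open>\<gamma> * w g\<close> and \<open>w g\<close>, so it suffices to find a \<open>5/6\<close>-PMMS allocation for the
  restricted additive valuations with weights \<open>w\<close>; passing back to \<open>v\<close> costs a factor \<open>\<gamma>\<close>.
  For those the longest-processing-time rule works: goods are handed out by decreasing weight, each
  to an agent of least load among those who value it. If \<open>g\<close> is the last good valued by \<open>i\<close> that
  \<open>j\<close> received, then just before, the goods of \<open>j\<close> that \<open>i\<close> values weighed at most as much as the
  goods of \<open>i\<close>. Either the load of \<open>i\<close> is at least \<open>5/2 * w g\<close>, and half of the total is a
  good enough bound, or at most two goods were in each bundle at that time and a finite case
  distinction remains. The algorithm only adds and compares reals.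
\<close>

section \<open>Splitting two bundles of weighted goods\<close>

lemma card_le_2_cases:
  assumes "finite S" "card S \<le> 2"
  obtains "S = {}" | a where "S = {a}" | a b where "S = {a, b}" "a \<noteq> b"
proof -
  have "card S = 0 \<or> card S = 1 \<or> card S = 2" using assms(2) by linarith
  then show thesis
    using that assms(1) by (auto simp: card_1_singleton_iff card_2_iff)
qed

lemma card_le_2_of_sum_less:
  fixes w :: "'a \<Rightarrow> real"
  assumes "finite S" "\<And>h. h \<in> S \<Longrightarrow> c \<le> w h" "sum w S < 5 / 2 * c" "c > 0"
  shows "card S \<le> 2"
proof (rule ccontr)
  assume "\<not> card S \<le> 2"
  then have "3 \<le> real (card S)" by simp
  then have "3 * c \<le> real (card S) * c" using assms(4) by (intro mult_right_mono) auto
  also have "\<dots> \<le> sum w S" using assms(2) by (intro sum_bounded_below) auto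
  finally show False using assms(3,4) by simp
qed

text \<open>\<open>A'\<close> stands for what \<open>A\<close> held when \<open>g\<close>, a
  lightest good of \<open>B\<close>, was handed out. A large \<open>sum w A\<close> is settled by
  averaging over \<open>X\<close> and \<open>Y\<close>; a small one leaves at most five goods in
  \<open>A'\<close> and \<open>B\<close> together, and all their splits are checked.\<close>

lemma greedy_pair_bound:
  fixes w :: "'a \<Rightarrow> real"
  assumes fin: "finite A" "finite B" and disj: "A \<inter> B = {}"
    and pos: "\<And>h. h \<in> A \<union> B \<Longrightarrow> w h > 0"
    and g: "g \<in> B" "\<And>h. h \<in> B \<Longrightarrow> w g \<le> w h"
    and A': "A' \<subseteq> A" "\<And>h. h \<in> A' \<Longrightarrow> w g \<le> w h"
    and le: "sum w (B - {g}) \<le> sum w A'"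
    and XY: "X \<union> Y = A \<union> B" "X \<inter> Y = {}"
  shows "5 / 6 * min (sum w X) (sum w Y) \<le> sum w A"
proof -
  define S where "S = A - A'"
  have finA': "finite A'" using A'(1) fin(1) finite_subset by blast
  have A_split: "sum w A = sum w S + sum w A'"
    unfolding S_def using sum.subset_diff[OF A'(1) fin(1)] by blast
  have S0: "sum w S \<ge> 0" unfolding S_def by (intro sum_nonneg) (use pos in \<open>force\<close>)
  have B_split: "sum w B = w g + sum w (B - {g})" using fin(2) g(1) by (simp add: sum.remove)
  have gpos: "w g > 0" using pos g(1) by blast
  have finXY: "finite X" "finite Y" using XY(1) fin by (metis finite_Un)+
  show ?thesis
  \<comment> \<open>Half of the total is at most \<open>sum w A + w g / 2\<close>, which is within
    \<open>6 / 5 * sum w A\<close> from the threshold \<open>5 / 2\<close> on. Below it, the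
    critical side takes one of two goods of \<open>A'\<close> and one of two goods of
    \<open>B - {g}\<close>; it weighs at most \<open>2 * (sum w A - w g)\<close>, which the same
    threshold keeps within \<open>6 / 5 * sum w A\<close>.\<close>
  proof (cases "sum w A < 5 / 2 * w g")
    case False
    have "sum w X + sum w Y = sum w A + sum w B"
      using XY fin finXY disj by (metis sum.union_disjoint)
    then show ?thesis using False B_split le A_split S0 by (simp add: min_def)
  next
    case True
    have cA: "card A' \<le> 2"
      using card_le_2_of_sum_less[of A' "w g" w] A'(2) gpos finA' True A_split S0 by auto
    have cB: "card (B - {g}) \<le> 2"
      using card_le_2_of_sum_less[of "B - {g}" "w g" w] g gpos fin(2) True A_split S0 le by auto
    \<comment> \<open>The goods in \<open>S\<close> can be many, so their whole weight is charged to
      both sides and only \<open>A' \<union> B\<close> is tracked good by good.\<close>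
    have part: "sum w Z \<le> sum w S + (\<Sum>h\<in>A' \<union> B. if h \<in> Z then w h else 0)"
      if "Z \<subseteq> A \<union> B" for Z
    proof -
      have "sum w Z = sum w (Z \<inter> S) + sum w ((A' \<union> B) \<inter> Z)"
        by (subst sum.union_disjoint[symmetric])
          (use that disj A'(1) fin finA' in \<open>auto simp: S_def intro!: arg_cong[of _ _ "sum w"]\<close>)
      moreover have "sum w (Z \<inter> S) \<le> sum w S"
        by (rule sum_mono2) (use fin pos in \<open>force simp: S_def\<close>)+
      ultimately show ?thesis using finA' fin by (simp add: sum.inter_restrict)
    qed
    have AB: "sum f (A' \<union> B) = sum f A' + f g + sum f (B - {g})" for f :: "'a \<Rightarrow> real"
      using disj A'(1) finA' fin g(1) by (subst sum.union_disjoint) (auto simp: sum.remove)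
    have XY_sub: "X \<subseteq> A \<union> B" "Y \<subseteq> A \<union> B" using XY(1) by blast+
    have X: "sum w X \<le> sum w S + (\<Sum>h\<in>A'. if h \<in> X then w h else 0)
        + (if g \<in> X then w g else 0) + (\<Sum>h\<in>B - {g}. if h \<in> X then w h else 0)"
      using part[OF XY_sub(1)] unfolding AB by linarith
    \<comment> \<open>Membership in \<open>Y\<close> becomes non-membership in \<open>X\<close>, so
      that each good causes a single case split at the end.\<close>
    have Y: "sum w Y \<le> sum w S + (\<Sum>h\<in>A'. if h \<notin> X then w h else 0)
        + (if g \<notin> X then w g else 0) + (\<Sum>h\<in>B - {g}. if h \<notin> X then w h else 0)"
    proof -
      have "h \<in> Y \<longleftrightarrow> h \<notin> X" if "h \<in> A' \<union> B" for h using that XY A'(1) by blast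
      then have "(\<Sum>h\<in>A' \<union> B. if h \<in> Y then w h else 0)
          = (\<Sum>h\<in>A' \<union> B. if h \<notin> X then w h else 0)" by (intro sum.cong) auto
      then show ?thesis using part[OF XY_sub(2)] unfolding AB by linarith
    qed
    define C where "C = B - {g}"
    have C: "\<forall>h\<in>C. w g \<le> w h" and A'g: "\<forall>h\<in>A'. w g \<le> w h"
      using g(2) A'(2) unfolding C_def by blast+
    note facts = X[folded C_def] Y[folded C_def] le[folded C_def] True[unfolded A_split] S0 gpos A'g C
    have finC: "finite C" "card C \<le> 2" using fin(2) cB unfolding C_def by auto
    have "5 * sum w X \<le> 6 * (sum w S + sum w A') \<or> 5 * sum w Y \<le> 6 * (sum w S + sum w A')"
      by (rule card_le_2_cases[OF finA' cA]; rule card_le_2_cases[OF finC];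
        use facts in \<open>auto split: if_splits\<close>)
    then show ?thesis unfolding A_split by (auto simp: min_def)
  qed
qed

section \<open>The invariant of the greedy rule\<close>

definition share :: "nat \<Rightarrow> (nat \<Rightarrow> nat) \<Rightarrow> nat \<Rightarrow> nat set" where
  "share m ow i = {g \<in> {1..m}. ow g = i}"

definition liked :: "(nat \<Rightarrow> nat \<Rightarrow> real) \<Rightarrow> nat \<Rightarrow> nat set \<Rightarrow> nat set" where
  "liked V i S = {g \<in> S. V i g > 0}"

text \<open>
  \<open>B\<close> is the part of another bundle that the owner of \<open>A\<close> values. The witness \<open>g\<close> is the last good
  of \<open>B\<close> handed out, and \<open>A'\<close> is the content of \<open>A\<close> at that moment.
\<close>

definition balanced :: "(nat \<Rightarrow> real) \<Rightarrow> nat set \<Rightarrow> nat set \<Rightarrow> bool" where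
  "balanced w A B \<longleftrightarrow> (B \<noteq> {} \<longrightarrow> (\<exists>g\<in>B. \<exists>A'\<subseteq>A. (\<forall>h\<in>B. w g \<le> w h) \<and> (\<forall>h\<in>A'. w g \<le> w h) \<and>
     sum w (B - {g}) \<le> sum w A'))"

text \<open>Goods that have not been handed out yet have owner \<open>0\<close>, which is not an agent.\<close>

definition greedy_inv ::
  "nat \<Rightarrow> nat \<Rightarrow> (nat \<Rightarrow> nat \<Rightarrow> real) \<Rightarrow> (nat \<Rightarrow> real) \<Rightarrow> (nat \<Rightarrow> nat) \<Rightarrow> (nat \<Rightarrow> real) \<Rightarrow> nat \<Rightarrow> bool" where
  "greedy_inv n m V w ow l r \<longleftrightarrow>
     (\<forall>g\<in>{1..m}. ow g \<le> n \<and> (ow g > 0 \<longrightarrow> V (ow g) g > 0)) \<and>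
     card {g \<in> {1..m}. ow g > 0} = r \<and>
     (\<forall>i\<in>{1..n}. l i = sum w (share m ow i)) \<and>
     (\<forall>g\<in>{1..m}. \<forall>h\<in>{1..m}. ow g > 0 \<longrightarrow> ow h = 0 \<longrightarrow> w h \<le> w g) \<and>
     (\<forall>i\<in>{1..n}. \<forall>j\<in>{1..n}. i \<noteq> j \<longrightarrow> balanced w (share m ow i) (liked V i (share m ow j)))"

lemma balanced_mono: "balanced w A B \<Longrightarrow> A \<subseteq> A' \<Longrightarrow> balanced w A' B"
  unfolding balanced_def by (meson subset_trans)

lemma share_update:
  assumes "b \<in> {1..m}" "ow b = 0" "i > 0"
  shows "share m (ow(b := a)) i = (if i = a then insert b (share m ow i) else share m ow i)"
  using assms by (auto simp: share_def)

lemma finite_share [simp]: "finite (share m ow i)"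
  by (simp add: share_def)

lemma greedy_inv_initial: "greedy_inv n m V w (\<lambda>_. 0) (\<lambda>_. 0) 0"
  by (auto simp: greedy_inv_def share_def liked_def balanced_def)

text \<open>Balance can only be disturbed from the viewpoint of an agent \<open>i\<close> who values
  \<open>b\<close>, towards the recipient \<open>a\<close>. Such an \<open>i\<close> was eligible
  too, so \<open>l a \<le> l i\<close>, and \<open>b\<close> with the current bundle of
  \<open>i\<close> is the new witness: by the decreasing order every good handed out so far weighs
  at least \<open>w b\<close>.\<close>

lemma greedy_inv_step:
  assumes inv: "greedy_inv n m V w ow l r"
    and w0: "\<And>g. g \<in> {1..m} \<Longrightarrow> w g \<ge> 0"
    and a: "a \<in> {1..n}" "V a b > 0" "\<And>i. i \<in> {1..n} \<Longrightarrow> V i b > 0 \<Longrightarrow> l a \<le> l i"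
    and b: "b \<in> {1..m}" "ow b = 0" "\<And>g. g \<in> {1..m} \<Longrightarrow> ow g = 0 \<Longrightarrow> w g \<le> w b"
  shows "greedy_inv n m V w (ow(b := a)) (l(a := l a + w b)) (Suc r)"
proof -
  have own: "ow g \<le> n" "ow g > 0 \<Longrightarrow> V (ow g) g > 0" if "g \<in> {1..m}" for g
    using inv that unfolding greedy_inv_def by blast+
  have num: "card {g \<in> {1..m}. ow g > 0} = r"
    and load: "\<And>i. i \<in> {1..n} \<Longrightarrow> l i = sum w (share m ow i)"
    and ord: "\<And>g h. g \<in> {1..m} \<Longrightarrow> h \<in> {1..m} \<Longrightarrow> ow g > 0 \<Longrightarrow> ow h = 0 \<Longrightarrow> w h \<le> w g"
    and bal: "\<And>i j. i \<in> {1..n} \<Longrightarrow> j \<in> {1..n} \<Longrightarrow> i \<noteq> j \<Longrightarrow>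
      balanced w (share m ow i) (liked V i (share m ow j))"
    using inv unfolding greedy_inv_def by blast+
  have nb: "b \<notin> share m ow i" if "i \<in> {1..n}" for i
    using b(2) that by (auto simp: share_def)
  have num': "card {g \<in> {1..m}. (ow(b := a)) g > 0} = Suc r"
  proof -
    have "{g \<in> {1..m}. (ow(b := a)) g > 0} = insert b {g \<in> {1..m}. ow g > 0}"
      using a(1) b(1) by auto
    then show ?thesis using num b(2) by simp
  qed
  have load': "(l(a := l a + w b)) i = sum w (share m (ow(b := a)) i)" if "i \<in> {1..n}" for i
    using that load[OF that] nb[OF that] share_update[of b m ow i a] b by (cases "i = a") simp_all
  have ord': "w h \<le> w g" if "g \<in> {1..m}" "h \<in> {1..m}" "(ow(b := a)) g > 0" "(ow(b := a)) h = 0" for g h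
    using that ord[of g h] b(3)[of h] a(1) by (auto split: if_splits)
  have bal': "balanced w (share m (ow(b := a)) i) (liked V i (share m (ow(b := a)) j))"
    if ij: "i \<in> {1..n}" "j \<in> {1..n}" "i \<noteq> j" for i j
  proof (cases "j = a \<and> V i b > 0")
    case False
    then have "liked V i (share m (ow(b := a)) j) = liked V i (share m ow j)"
      using ij share_update[of b m ow j a] b by (auto simp: liked_def)
    moreover have "share m ow i \<subseteq> share m (ow(b := a)) i"
      using b(2) ij by (auto simp: share_def)
    ultimately show ?thesis using bal[OF ij] balanced_mono by metis
  next
    case True
    let ?B = "liked V i (share m ow a)"
    have B: "liked V i (share m (ow(b := a)) j) = insert b ?B"
      using True ij share_update[of b m ow j a] b by (auto simp: liked_def)
    have A: "share m (ow(b := a)) i = share m ow i"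
      using True ij share_update[of b m ow i a] b by simp
    have sub: "?B \<subseteq> share m ow a" by (auto simp: liked_def)
    \<comment> \<open>\<open>i\<close> may value only some goods of \<open>a\<close>, so the load of
      \<open>a\<close> bounds their weight from above.\<close>
    have "sum w ?B \<le> sum w (share m ow a)"
      by (rule sum_mono2) (use sub w0 in \<open>auto simp: share_def\<close>)
    also have "\<dots> = l a" using load a(1) by simp
    also have "\<dots> \<le> l i" using a(3) ij True by blast
    also have "\<dots> = sum w (share m ow i)" using load ij by simp
    also have "?B = insert b ?B - {b}" using nb[OF a(1)] sub by blast
    finally have le: "sum w (insert b ?B - {b}) \<le> sum w (share m ow i)" .
    have assigned: "w b \<le> w h" if "h \<in> share m ow k" "k > 0" for h k
      using that b ord by (auto simp: share_def)
    have "\<forall>h\<in>insert b ?B. w b \<le> w h" "\<forall>h\<in>share m ow i. w b \<le> w h"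
      using assigned sub a(1) ij(1) by fastforce+
    then show ?thesis unfolding A B balanced_def using le by blast
  qed
  have own': "(ow(b := a)) g \<le> n \<and> ((ow(b := a)) g > 0 \<longrightarrow> V ((ow(b := a)) g) g > 0)"
    if "g \<in> {1..m}" for g
    using own[OF that] a by simp
  show ?thesis unfolding greedy_inv_def using own' num' load' ord' bal' by blast
qed

lemma greedy_pair:
  assumes inv: "greedy_inv n m V w ow l r" and w: "\<And>g. g \<in> {1..m} \<Longrightarrow> w g > 0"
    and ij: "i \<in> {1..n}" "j \<in> {1..n}" "i \<noteq> j"
    and XY: "X \<union> Y = share m ow i \<union> liked V i (share m ow j)" "X \<inter> Y = {}"
  shows "5 / 6 * min (sum w X) (sum w Y) \<le> sum w (share m ow i)"
proof (cases "liked V i (share m ow j) = {}")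
  \<comment> \<open>\<open>balanced\<close> supplies no witness here, but both sides lie inside the
    bundle of \<open>i\<close>.\<close>
  case True
  have "sum w Z \<le> sum w (share m ow i)" "sum w Z \<ge> 0" if "Z \<subseteq> share m ow i" for Z
  proof -
    have "w h \<ge> 0" if "h \<in> share m ow i" for h
      using that w[of h] by (simp add: share_def less_imp_le)
    then show "sum w Z \<le> sum w (share m ow i)" "sum w Z \<ge> 0"
      using that by (auto intro!: sum_mono2 sum_nonneg)
  qed
  then have "sum w X \<le> sum w (share m ow i)" "sum w X \<ge> 0" using XY True by blast+
  then show ?thesis by (simp add: min_def)
next
  case False
  let ?A = "share m ow i" and ?B = "liked V i (share m ow j)"
  have "balanced w ?A ?B" using inv ij unfolding greedy_inv_def by blast
  then obtain g A' where g: "g \<in> ?B" "A' \<subseteq> ?A" "\<forall>h\<in>?B. w g \<le> w h" "\<forall>h\<in>A'. w g \<le> w h"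
    "sum w (?B - {g}) \<le> sum w A'"
    using False unfolding balanced_def by blast
  show ?thesis
    by (rule greedy_pair_bound[of ?A ?B w g A'])
      (use g XY w ij in \<open>auto simp: liked_def share_def\<close>)
qed

section \<open>Time-bounded total correctness\<close>

definition runs :: "com \<Rightarrow> state \<Rightarrow> nat \<Rightarrow> (state \<Rightarrow> bool) \<Rightarrow> bool" where
  "runs c s T Q \<longleftrightarrow> (\<exists>t s'. exec c s t s' \<and> t \<le> T \<and> Q s')"

lemma runs_mono: "runs c s T Q \<Longrightarrow> T \<le> T' \<Longrightarrow> (\<And>s'. Q s' \<Longrightarrow> Q' s') \<Longrightarrow> runs c s T' Q'"
  unfolding runs_def by (meson order_trans)

lemma runs_Seq:
  assumes "runs c s T P" "\<And>s'. P s' \<Longrightarrow> runs d s' U Q"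
  shows "runs (Seq c d) s (T + U) Q"
  using assms unfolding runs_def by (meson add_mono exec.Seq)

text \<open>Induction on the number of rounds left; \<open>P\<close> is indexed by the rounds done.
  \<open>Suc T\<close> includes the test of each round, and the final \<open>1\<close> is the
  failing test.\<close>

lemma runs_While:
  assumes "\<And>k s. k < N \<Longrightarrow> P k s \<Longrightarrow> bval b s \<and> runs c s T (P (Suc k))"
    and "\<And>s. P N s \<Longrightarrow> \<not> bval b s" and "P 0 s"
  shows "runs (While b c) s (N * Suc T + 1) (P N)"
proof -
  have "runs (While b c) s ((N - k) * Suc T + 1) (P N)" if "k \<le> N" "P k s" for k s
    using that
  proof (induction "N - k" arbitrary: k s)
    case 0
    then have "k = N" by simp
    then have "P N s" using 0(3) by simp
    moreover have "exec (While b c) s 1 s"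
      by (rule exec.WhileFalse) (use assms(2) \<open>P N s\<close> in blast)
    ultimately show ?case unfolding runs_def by (intro exI[of _ 1] exI[of _ s]) simp
  next
    case (Suc d)
    then have k: "k < N" by simp
    from assms(1)[OF k Suc.prems(2)] obtain t s' where
      b: "bval b s" and c: "exec c s t s'" "t \<le> T" "P (Suc k) s'" unfolding runs_def by blast
    have "d = N - Suc k" "Suc k \<le> N" using Suc.hyps(2) k by simp_all
    then obtain t' s'' where
      w: "exec (While b c) s' t' s''" "t' \<le> (N - Suc k) * Suc T + 1" "P N s''"
      using Suc.hyps(1) c(3) unfolding runs_def by blast
    have "1 + t + t' \<le> Suc (N - Suc k) * Suc T + 1" using c(2) w(2) by simp
    moreover have "Suc (N - Suc k) = N - k" using k by simp
    ultimately show ?case using exec.WhileTrue[OF b c(1) w(1)] w(3) unfolding runs_def by metis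
  qed
  from this[of 0 s] assms(3) show ?thesis by simp
qed

fun loop_free :: "com \<Rightarrow> bool" where
  "loop_free (Seq c d) \<longleftrightarrow> loop_free c \<and> loop_free d"
| "loop_free (Cond b c d) \<longleftrightarrow> loop_free c \<and> loop_free d"
| "loop_free (While b c) \<longleftrightarrow> False"
| "loop_free c \<longleftrightarrow> True"

text \<open>Loop-free commands act as functions, which lets the simplifier evaluate them. The
  catch-all clause gives \<open>While\<close> the identity as a default;
  \<open>runs_loop_free\<close> excludes it by \<open>loop_free\<close>.\<close>

fun effect :: "com \<Rightarrow> state \<Rightarrow> state" where
  "effect (NAssign x e f) s = (upd (fst s) x (nval e s) (nval f s), snd s)"
| "effect (RAssign x e f) s = (fst s, upd (snd s) x (nval e s) (rval f s))"
| "effect (Seq c d) s = effect d (effect c s)"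
| "effect (Cond b c d) s = (if bval b s then effect c s else effect d s)"
| "effect c s = s"

fun cost :: "com \<Rightarrow> nat" where
  "cost (Seq c d) = cost c + cost d"
| "cost (Cond b c d) = 1 + max (cost c) (cost d)"
| "cost c = 1"

text \<open>Only a bound on the time results, as \<open>cost\<close> takes the dearer branch of each
  conditional.\<close>

lemma runs_loop_free:
  assumes "loop_free c" "Q (effect c s)" "cost c \<le> T"
  shows "runs c s T Q"
proof -
  have "\<exists>t. exec c s t (effect c s) \<and> t \<le> cost c" using assms(1)
  proof (induction c arbitrary: s)
    case (Seq c d)
    from Seq.IH(1)[of s] Seq.IH(2)[of "effect c s"] Seq.prems obtain t u where
      "exec c s t (effect c s)" "t \<le> cost c"
      "exec d (effect c s) u (effect d (effect c s))" "u \<le> cost d" by auto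
    then show ?case using exec.Seq by (intro exI[of _ "t + u"]) auto
  next
    case (Cond b c d)
    from Cond.IH(1)[of s] Cond.IH(2)[of s] Cond.prems obtain t u where tu:
      "exec c s t (effect c s)" "t \<le> cost c" "exec d s u (effect d s)" "u \<le> cost d" by auto
    show ?case
    proof (cases "bval b s")
      case True
      then show ?thesis using tu exec.CondTrue[of b s c t _ d] by (intro exI[of _ "1 + t"]) auto
    next
      case False
      then show ?thesis using tu exec.CondFalse[of b s d u _ c] by (intro exI[of _ "1 + u"]) auto
    qed
  qed (auto intro: exec.intros)
  then show ?thesis using assms(2,3) unfolding runs_def by (meson order_trans)
qed

section \<open>The greedy program\<close>

abbreviation ncell :: "vname \<Rightarrow> nexp" where "ncell x \<equiv> NCell x (NConst 0)"
abbreviation rcell :: "vname \<Rightarrow> rexp" where "rcell x \<equiv> RCell x (NConst 0)"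
abbreviation nset :: "vname \<Rightarrow> nexp \<Rightarrow> com" where "nset x \<equiv> NAssign x (NConst 0)"
abbreviation incr :: "vname \<Rightarrow> com" where "incr x \<equiv> nset x (NAdd (ncell x) (NConst 1))"

text \<open>
  The search for the heaviest free good scans the valuation matrix in row-major order, so no weights
  have to be computed beforehand: the largest entry in a column of a free good is its weight.
  Address \<open>k\<close> belongs to agent \<open>k div m + 1\<close> and good \<open>k mod m + 1\<close>.
\<close>

definition good_init :: com where
  "good_init = Seq (nset ''k'' (NConst 0)) (Seq (nset ''g'' (NConst 1)) (Seq (nset ''i'' (NConst 0))
     (RAssign ''x'' (NConst 0) (RConst 0))))"

text \<open>Expressions have no division, so \<open>g\<close> and \<open>i\<close> are counters that
  follow \<open>k mod m + 1\<close> and \<open>k div m\<close>; here \<open>i\<close> counts from 0.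
  With \<open>x\<close> starting at 0, the strict comparison accepts positive values only.\<close>

definition good_body :: com where
  "good_body =
     Seq (Cond (BAnd (NLess (NCell ''owner'' (ncell ''g'')) (NConst 1))
                     (RLess (rcell ''x'') (RCell ''v'' (ncell ''k''))))
           (Seq (RAssign ''x'' (NConst 0) (RCell ''v'' (ncell ''k''))) (nset ''b'' (ncell ''g'')))
           Skip)
     (Seq (incr ''k'')
       (Cond (NLess (ncell ''g'') (ncell ''m''))
         (incr ''g'')
         (Seq (nset ''g'' (NConst 1)) (incr ''i''))))"

text \<open>Column \<open>b\<close> starts at address \<open>b - 1\<close> and is walked in steps of
  \<open>m\<close>. The value 0 of \<open>a\<close> stands for no candidate so far.\<close>

definition agent_init :: com where
  "agent_init = Seq (nset ''k'' (NSub (ncell ''b'') (NConst 1)))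
     (Seq (nset ''i'' (NConst 0)) (nset ''a'' (NConst 0)))"

text \<open>\<open>i\<close> is advanced first and so is the actual agent number in the test. The
  nested negations say: no candidate yet, or a strictly smaller load.\<close>

definition agent_body :: com where
  "agent_body =
     Seq (incr ''i'')
     (Seq (Cond (BAnd (RLess (RConst 0) (RCell ''v'' (ncell ''k'')))
                  (BNot (BAnd (NLess (NConst 0) (ncell ''a''))
                     (BNot (RLess (RCell ''load'' (ncell ''i'')) (RCell ''load'' (ncell ''a'')))))))
            (nset ''a'' (ncell ''i'')) Skip)
       (nset ''k'' (NAdd (ncell ''k'') (ncell ''m''))))"

text \<open>The load grows by \<open>x\<close>, the largest value any agent has for the good, not by
  the recipient's own value.\<close>

definition assign_good :: com where
  "assign_good = Seq (NAssign ''owner'' (ncell ''b'') (ncell ''a''))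
     (Seq (RAssign ''load'' (ncell ''a'') (RAdd (RCell ''load'' (ncell ''a'')) (rcell ''x'')))
       (incr ''r''))"

definition greedy_round :: com where
  "greedy_round = Seq good_init (Seq (While (NLess (ncell ''i'') (ncell ''n'')) good_body)
     (Seq agent_init (Seq (While (NLess (ncell ''i'') (ncell ''n'')) agent_body) assign_good)))"

definition greedy :: com where
  "greedy = While (NLess (ncell ''r'') (ncell ''m'')) greedy_round"

section \<open>Correctness and running time of the program\<close>

definition stores ::
  "nat \<Rightarrow> nat \<Rightarrow> (nat \<Rightarrow> nat \<Rightarrow> real) \<Rightarrow> (nat \<Rightarrow> nat) \<Rightarrow> (nat \<Rightarrow> real) \<Rightarrow> nat \<Rightarrow> state \<Rightarrow> bool" where
  "stores n m V ow l r s \<longleftrightarrow> fst s ''n'' 0 = n \<and> fst s ''m'' 0 = m \<and>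
     (\<forall>k < n * m. snd s ''v'' k = V (k div m + 1) (k mod m + 1)) \<and>
     fst s ''owner'' = ow \<and> snd s ''load'' = l \<and> fst s ''r'' 0 = r"

text \<open>The first \<open>k\<close> matrix entries have been scanned. While \<open>x\<close> is
  0, \<open>b\<close> may be left over from an earlier round, hence the positivity guard on the last
  conjunct.\<close>

definition good_inv ::
  "nat \<Rightarrow> nat \<Rightarrow> (nat \<Rightarrow> nat \<Rightarrow> real) \<Rightarrow> (nat \<Rightarrow> nat) \<Rightarrow> (nat \<Rightarrow> real) \<Rightarrow> nat \<Rightarrow> nat \<Rightarrow> state \<Rightarrow> bool" where
  "good_inv n m V ow l r k s \<longleftrightarrow> stores n m V ow l r s \<and>
     fst s ''k'' 0 = k \<and> fst s ''g'' 0 = k mod m + 1 \<and> fst s ''i'' 0 = k div m \<and>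
     snd s ''x'' 0 \<ge> 0 \<and>
     (\<forall>k' < k. ow (k' mod m + 1) = 0 \<longrightarrow> V (k' div m + 1) (k' mod m + 1) \<le> snd s ''x'' 0) \<and>
     (snd s ''x'' 0 > 0 \<longrightarrow> ow (fst s ''b'' 0) = 0 \<and>
       (\<exists>k' < k. fst s ''b'' 0 = k' mod m + 1 \<and> snd s ''x'' 0 = V (k' div m + 1) (k' mod m + 1)))"

text \<open>The first \<open>i\<close> agents have been compared; \<open>k\<close> is the address
  for agent \<open>i + 1\<close>. The last conjunct forces a candidate as soon as one of them values
  \<open>b\<close>.\<close>

definition agent_inv ::
  "nat \<Rightarrow> nat \<Rightarrow> (nat \<Rightarrow> nat \<Rightarrow> real) \<Rightarrow> (nat \<Rightarrow> nat) \<Rightarrow> (nat \<Rightarrow> real) \<Rightarrow> nat \<Rightarrow> nat \<Rightarrow> real \<Rightarrow> nat \<Rightarrow> state \<Rightarrow> bool" where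
  "agent_inv n m V ow l r b x i s \<longleftrightarrow> stores n m V ow l r s \<and>
     fst s ''b'' 0 = b \<and> snd s ''x'' 0 = x \<and> fst s ''i'' 0 = i \<and> fst s ''k'' 0 = i * m + (b - 1) \<and>
     fst s ''a'' 0 \<le> i \<and> (fst s ''a'' 0 > 0 \<longrightarrow> V (fst s ''a'' 0) b > 0) \<and>
     (\<forall>j\<in>{1..i}. V j b > 0 \<longrightarrow> fst s ''a'' 0 > 0 \<and> l (fst s ''a'' 0) \<le> l j)"

lemma good_body_runs:
  assumes inv: "good_inv n m V ow l r k s" and k: "k < n * m"
  shows "runs good_body s 10 (good_inv n m V ow l r (Suc k))"
proof (rule runs_loop_free)
  show "loop_free good_body" "cost good_body \<le> 10" by (simp_all add: good_body_def)
  have m: "m > 0" using k by (cases m) auto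
  \<comment> \<open>Either the scan stays in its row or \<open>k\<close> is in the last column; this
    decides the branch that updates \<open>g\<close> and \<open>i\<close>.\<close>
  have mod_less: "Suc (k mod m) < m \<or> Suc (k mod m) = m"
    using mod_less_divisor[OF m, of k] by linarith
  define s' where "s' = effect good_body s"
  define y where "y = V (k div m + 1) (k mod m + 1)"
  define better where "better \<longleftrightarrow> ow (k mod m + 1) = 0 \<and> snd s ''x'' 0 < y"
  have st: "fst s ''n'' 0 = n" "fst s ''m'' 0 = m" "fst s ''owner'' = ow" "snd s ''load'' = l"
    "fst s ''r'' 0 = r" "\<forall>k<n * m. snd s ''v'' k = V (k div m + 1) (k mod m + 1)"
    and k0: "fst s ''k'' 0 = k" and g0: "fst s ''g'' 0 = k mod m + 1" and i0: "fst s ''i'' 0 = k div m"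
    and x0: "snd s ''x'' 0 \<ge> 0"
    and ub: "\<And>k'. k' < k \<Longrightarrow> ow (k' mod m + 1) = 0 \<Longrightarrow>
      V (k' div m + 1) (k' mod m + 1) \<le> snd s ''x'' 0"
    and att: "snd s ''x'' 0 > 0 \<Longrightarrow> ow (fst s ''b'' 0) = 0 \<and>
      (\<exists>k' < k. fst s ''b'' 0 = k' mod m + 1 \<and> snd s ''x'' 0 = V (k' div m + 1) (k' mod m + 1))"
    using inv unfolding good_inv_def stores_def by blast+
  have yk: "snd s ''v'' k = y" using st(6) k unfolding y_def by blast
  have stores: "stores n m V ow l r s'"
    unfolding stores_def s'_def good_body_def by (simp add: upd_def st)
  have k': "fst s' ''k'' 0 = Suc k"
    unfolding s'_def good_body_def by (simp add: upd_def k0)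
  have g': "fst s' ''g'' 0 = Suc k mod m + 1" and i': "fst s' ''i'' 0 = Suc k div m"
    using mod_less m unfolding s'_def good_body_def
    by (auto simp add: upd_def st g0 i0 mod_Suc div_Suc)
  have x': "snd s' ''x'' 0 = (if better then y else snd s ''x'' 0)"
    and b': "fst s' ''b'' 0 = (if better then k mod m + 1 else fst s ''b'' 0)"
    unfolding s'_def good_body_def better_def by (simp_all add: upd_def st(3) g0 k0 yk)
  have "good_inv n m V ow l r (Suc k) s'"
    unfolding good_inv_def
  proof (intro conjI stores k' g' i' allI impI)
    show "snd s' ''x'' 0 \<ge> 0" using x0 x' unfolding better_def by auto
    fix j assume j: "j < Suc k" "ow (j mod m + 1) = 0"
    show "V (j div m + 1) (j mod m + 1) \<le> snd s' ''x'' 0"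
    proof (cases "j = k")
      case True
      then show ?thesis using j x' unfolding better_def y_def by auto
    next
      case False
      then have "V (j div m + 1) (j mod m + 1) \<le> snd s ''x'' 0" using ub j by simp
      then show ?thesis using x' unfolding better_def by auto
    qed
  next
    assume pos: "0 < snd s' ''x'' 0"
    show "ow (fst s' ''b'' 0) = 0"
      using att pos x' b' unfolding better_def by (auto split: if_splits)
    show "\<exists>k'<Suc k. fst s' ''b'' 0 = k' mod m + 1 \<and> snd s' ''x'' 0 = V (k' div m + 1) (k' mod m + 1)"
    proof (cases better)
      case True
      then show ?thesis using x' b' unfolding y_def by (intro exI[of _ k]) simp
    next
      case False
      then show ?thesis using att pos x' b' less_SucI by (smt (verit, ccfv_threshold))
    qed
  qed
  then show "good_inv n m V ow l r (Suc k) (effect good_body s)" unfolding s'_def .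
qed

lemma row_major:
  fixes m :: nat
  assumes "d < m"
  shows "(q * m + d) div m = q" "(q * m + d) mod m = d"
  using assms by auto

lemma agent_body_runs:
  assumes inv: "agent_inv n m V ow l r b x i s" and i: "i < n" and b: "b \<in> {1..m}"
  shows "runs agent_body s 10 (agent_inv n m V ow l r b x (Suc i))"
proof (rule runs_loop_free)
  show "loop_free agent_body" "cost agent_body \<le> 10" by (simp_all add: agent_body_def)
  define k where "k = i * m + (b - 1)"
  define s' where "s' = effect agent_body s"
  have "k < Suc i * m" unfolding k_def using b by auto
  also have "\<dots> \<le> n * m" using i by (intro mult_right_mono) auto
  finally have k: "k < n * m" .
  have "b - 1 < m" using b by auto
  then have kdm: "k div m = i" "k mod m = b - 1" unfolding k_def by (simp_all only: row_major)
  have st: "fst s ''n'' 0 = n" "fst s ''m'' 0 = m" "fst s ''owner'' = ow" "snd s ''load'' = l"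
    "fst s ''r'' 0 = r" "\<forall>k<n * m. snd s ''v'' k = V (k div m + 1) (k mod m + 1)"
    and b0: "fst s ''b'' 0 = b" and x0: "snd s ''x'' 0 = x" and i0: "fst s ''i'' 0 = i"
    and k0: "fst s ''k'' 0 = k" and a0: "fst s ''a'' 0 \<le> i"
    and a1: "fst s ''a'' 0 > 0 \<Longrightarrow> V (fst s ''a'' 0) b > 0"
    and lb: "\<And>j. j \<in> {1..i} \<Longrightarrow> V j b > 0 \<Longrightarrow> fst s ''a'' 0 > 0 \<and> l (fst s ''a'' 0) \<le> l j"
    using inv unfolding agent_inv_def stores_def k_def by blast+
  define better where "better \<longleftrightarrow> V (Suc i) b > 0 \<and> (fst s ''a'' 0 > 0 \<longrightarrow> l (Suc i) < l (fst s ''a'' 0))"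
  have "snd s ''v'' k = V (k div m + 1) (k mod m + 1)" using st(6) k by blast
  also have "\<dots> = V (Suc i) b" using kdm b by simp
  finally have v: "snd s ''v'' k = V (Suc i) b" .
  have stores: "stores n m V ow l r s'"
    unfolding stores_def s'_def agent_body_def by (simp add: upd_def st)
  have b': "fst s' ''b'' 0 = b" and x': "snd s' ''x'' 0 = x" and i': "fst s' ''i'' 0 = Suc i"
    unfolding s'_def agent_body_def by (simp_all add: upd_def b0 x0 i0)
  have k': "fst s' ''k'' 0 = Suc i * m + (b - 1)"
    unfolding s'_def agent_body_def by (simp add: upd_def k0 st) (simp add: k_def)
  have a': "fst s' ''a'' 0 = (if better then Suc i else fst s ''a'' 0)"
    unfolding s'_def agent_body_def better_def by (auto simp: upd_def st(4) k0 i0 v)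
  have "agent_inv n m V ow l r b x (Suc i) s'"
    unfolding agent_inv_def
  proof (intro conjI stores b' x' i' k' ballI impI)
    show "fst s' ''a'' 0 \<le> Suc i" using a' a0 by auto
    show "V (fst s' ''a'' 0) b > 0" if "fst s' ''a'' 0 > 0"
      using that a' a1 unfolding better_def by (auto split: if_splits)
    fix j assume j: "j \<in> {1..Suc i}" "V j b > 0"
    have "fst s' ''a'' 0 > 0 \<and> l (fst s' ''a'' 0) \<le> l j"
    proof (cases "j = Suc i")
      case True
      then show ?thesis using a' j unfolding better_def by auto
    next
      case False
      then have "j \<in> {1..i}" using j by auto
      then have "fst s ''a'' 0 > 0 \<and> l (fst s ''a'' 0) \<le> l j" using lb j by blast
      then show ?thesis using a' unfolding better_def by auto
    qed
    then show "fst s' ''a'' 0 > 0" "l (fst s' ''a'' 0) \<le> l j" by blast+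
  qed
  then show "agent_inv n m V ow l r b x (Suc i) (effect agent_body s)" unfolding s'_def .
qed

text \<open>The postcondition avoids weights: \<open>x\<close> is the largest value of any agent for
  any free good, attained in column \<open>b\<close>.\<close>

lemma greedy_round_runs:
  assumes st: "stores n m V ow l r s" and m: "m > 0"
    and likes: "\<And>g. g \<in> {1..m} \<Longrightarrow> \<exists>i\<in>{1..n}. V i g > 0"
    and free: "g0 \<in> {1..m}" "ow g0 = 0"
  shows "runs greedy_round s (11 * (n * m) + 11 * n + 12)
    (\<lambda>s'. \<exists>a b x. a \<in> {1..n} \<and> V a b > 0 \<and> (\<forall>i\<in>{1..n}. V i b > 0 \<longrightarrow> l a \<le> l i) \<and>
       b \<in> {1..m} \<and> ow b = 0 \<and> (\<exists>i\<in>{1..n}. V i b = x) \<and>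
       (\<forall>i\<in>{1..n}. \<forall>g\<in>{1..m}. ow g = 0 \<longrightarrow> V i g \<le> x) \<and>
       stores n m V (ow(b := a)) (l(a := l a + x)) (Suc r) s')"
    (is "runs _ _ _ ?Q")
proof -
  \<comment> \<open>The address map and its inverse turn a maximum over addresses into one over
    agents and goods.\<close>
  have cell: "(i - 1) * m + (g - 1) < n * m" "((i - 1) * m + (g - 1)) div m + 1 = i"
    "((i - 1) * m + (g - 1)) mod m + 1 = g" if "i \<in> {1..n}" "g \<in> {1..m}" for i g
  proof -
    have g: "g - 1 < m" using that by auto
    then have "(i - 1) * m + (g - 1) < Suc (i - 1) * m" by simp
    also have "\<dots> \<le> n * m" using that by (intro mult_right_mono) auto
    finally show "(i - 1) * m + (g - 1) < n * m" .
    show "((i - 1) * m + (g - 1)) div m + 1 = i" "((i - 1) * m + (g - 1)) mod m + 1 = g"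
      using that by (simp_all only: row_major[OF g]) auto
  qed
  let ?choice = "\<lambda>b x. b \<in> {1..m} \<and> ow b = 0 \<and> (\<exists>i\<in>{1..n}. V i b = x) \<and>
    (\<forall>i\<in>{1..n}. \<forall>g\<in>{1..m}. ow g = 0 \<longrightarrow> V i g \<le> x)"
  have choice: "?choice (fst s ''b'' 0) (snd s ''x'' 0)" if "good_inv n m V ow l r (n * m) s" for s
  proof -
    let ?b = "fst s ''b'' 0" and ?x = "snd s ''x'' 0"
    have ub: "\<And>k'. k' < n * m \<Longrightarrow> ow (k' mod m + 1) = 0 \<Longrightarrow> V (k' div m + 1) (k' mod m + 1) \<le> ?x"
      and att: "?x > 0 \<Longrightarrow> ow ?b = 0 \<and>
        (\<exists>k' < n * m. ?b = k' mod m + 1 \<and> ?x = V (k' div m + 1) (k' mod m + 1))"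
      using that unfolding good_inv_def by blast+
    have le: "V i g \<le> ?x" if "i \<in> {1..n}" "g \<in> {1..m}" "ow g = 0" for i g
      using ub[OF cell(1)[OF that(1,2)], unfolded cell(2,3)[OF that(1,2)]] that(3) by blast
    \<comment> \<open>The free good \<open>g0\<close> has positive value for someone, so the scan
      ends with a positive \<open>x\<close> and a valid \<open>b\<close>.\<close>
    obtain i0 where "i0 \<in> {1..n}" "V i0 g0 > 0" using likes free(1) by blast
    then have "?x > 0" using le[of i0 g0] free by linarith
    then obtain k where k: "ow ?b = 0" "k < n * m" "?b = k mod m + 1"
      "?x = V (k div m + 1) (k mod m + 1)" using att by blast
    have "k div m < n" using k(2) by (simp add: less_mult_imp_div_less)
    then have "k div m + 1 \<in> {1..n}" by auto
    moreover have "?b \<in> {1..m}" using k(3) mod_less_divisor[OF m, of k] by auto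
    ultimately show ?thesis using k(1) k(4)[symmetric] le unfolding k(3)[symmetric] by blast
  qed
  have init: "runs good_init s 4 (good_inv n m V ow l r 0)"
    by (rule runs_loop_free) (use st in \<open>auto simp: good_init_def good_inv_def stores_def upd_def\<close>)
  have goods: "runs (While (NLess (ncell ''i'') (ncell ''n'')) good_body) s' (n * m * Suc 10 + 1)
      (good_inv n m V ow l r (n * m))" if "good_inv n m V ow l r 0 s'" for s'
  proof (rule runs_While[where P = "good_inv n m V ow l r"])
    show "bval (NLess (ncell ''i'') (ncell ''n'')) s \<and> runs good_body s 10 (good_inv n m V ow l r (Suc k))"
      if "k < n * m" "good_inv n m V ow l r k s" for k s
      using good_body_runs[OF that(2,1)] that
      by (simp add: good_inv_def stores_def less_mult_imp_div_less)
    show "\<not> bval (NLess (ncell ''i'') (ncell ''n'')) s" if "good_inv n m V ow l r (n * m) s" for s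
      using that m by (simp add: good_inv_def stores_def)
  qed (rule that)
  have init': "runs agent_init s' 3 (\<lambda>s'. \<exists>b x. ?choice b x \<and> agent_inv n m V ow l r b x 0 s')"
    if "good_inv n m V ow l r (n * m) s'" for s'
  proof (rule runs_loop_free)
    have st': "stores n m V ow l r s'" using that unfolding good_inv_def by blast
    have "agent_inv n m V ow l r (fst s' ''b'' 0) (snd s' ''x'' 0) 0 (effect agent_init s')"
      using st' by (simp add: agent_init_def agent_inv_def stores_def upd_def)
    then show "\<exists>b x. ?choice b x \<and> agent_inv n m V ow l r b x 0 (effect agent_init s')"
      using choice[OF that] by blast
  qed (simp_all add: agent_init_def)
  have agents: "runs (While (NLess (ncell ''i'') (ncell ''n'')) agent_body) s' (n * Suc 10 + 1)
      (\<lambda>s'. \<exists>b x. ?choice b x \<and> agent_inv n m V ow l r b x n s')"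
    if "\<exists>b x. ?choice b x \<and> agent_inv n m V ow l r b x 0 s'" for s'
  proof -
    from that obtain b x where c: "?choice b x" and a: "agent_inv n m V ow l r b x 0 s'" by blast
    have "runs (While (NLess (ncell ''i'') (ncell ''n'')) agent_body) s' (n * Suc 10 + 1)
        (agent_inv n m V ow l r b x n)"
    proof (rule runs_While[where P = "agent_inv n m V ow l r b x"])
      show "bval (NLess (ncell ''i'') (ncell ''n'')) s \<and>
          runs agent_body s 10 (agent_inv n m V ow l r b x (Suc i))"
        if "i < n" "agent_inv n m V ow l r b x i s" for i s
        using agent_body_runs[OF that(2,1)] that c by (simp add: agent_inv_def stores_def)
      show "\<not> bval (NLess (ncell ''i'') (ncell ''n'')) s" if "agent_inv n m V ow l r b x n s" for s
        using that by (simp add: agent_inv_def stores_def)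
    qed (rule a)
    then show ?thesis by (rule runs_mono) (use c in blast)+
  qed
  have final: "runs assign_good s' 3 ?Q"
    if "\<exists>b x. ?choice b x \<and> agent_inv n m V ow l r b x n s'" for s'
  proof (rule runs_loop_free)
    from that obtain b x where c: "?choice b x" and a: "agent_inv n m V ow l r b x n s'" by blast
    let ?a = "fst s' ''a'' 0"
    have st': "stores n m V ow l r s'" and b: "fst s' ''b'' 0 = b" and x: "snd s' ''x'' 0 = x"
      using a unfolding agent_inv_def by blast+
    have lb: "\<forall>j\<in>{1..n}. V j b > 0 \<longrightarrow> ?a > 0 \<and> l ?a \<le> l j"
      and a1: "?a \<le> n" "?a > 0 \<longrightarrow> V ?a b > 0" using a unfolding agent_inv_def by blast+
    \<comment> \<open>Someone values \<open>b\<close>, so the scan cannot end with the default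
      candidate 0.\<close>
    obtain j where "j \<in> {1..n}" "V j b > 0" using likes c by blast
    then have "?a > 0" using lb by blast
    then have "?a \<in> {1..n}" "V ?a b > 0" using a1 by auto
    moreover have "stores n m V (ow(b := ?a)) (l(?a := l ?a + x)) (Suc r) (effect assign_good s')"
      using st' x b by (simp add: assign_good_def stores_def upd_def)
    ultimately show "?Q (effect assign_good s')" using c lb by blast
  qed (simp_all add: assign_good_def)
  \<comment> \<open>The straight-line parts cost 4, 3 and 3 and each loop has one failing test,
    which gives the 12 of the bound; an iteration costs at most 10 plus its test.\<close>
  have "runs greedy_round s (4 + ((n * m * Suc 10 + 1) + (3 + ((n * Suc 10 + 1) + 3)))) ?Q"
    unfolding greedy_round_def by (intro runs_Seq[OF init] runs_Seq[OF goods] runs_Seq[OF init']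
      runs_Seq[OF agents] final)
  then show ?thesis by (rule runs_mono) simp_all
qed

lemma greedy_runs:
  assumes init: "stores n m V (\<lambda>_. 0) (\<lambda>_. 0) 0 s"
    and likes: "\<And>g. g \<in> {1..m} \<Longrightarrow> \<exists>i\<in>{1..n}. V i g > 0"
    and ub: "\<And>i g. i \<in> {1..n} \<Longrightarrow> g \<in> {1..m} \<Longrightarrow> V i g \<le> w g"
    and att: "\<And>g. g \<in> {1..m} \<Longrightarrow> \<exists>i\<in>{1..n}. V i g = w g"
  shows "runs greedy s (m * Suc (11 * (n * m) + 11 * n + 12) + 1)
    (\<lambda>s. \<exists>ow l. greedy_inv n m V w ow l m \<and> stores n m V ow l m s)"
proof -
  have w0: "w g \<ge> 0" if "g \<in> {1..m}" for g using likes[OF that] ub[OF _ that] by fastforce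
  show ?thesis unfolding greedy_def
  proof (rule runs_While[where P = "\<lambda>k s. \<exists>ow l. greedy_inv n m V w ow l k \<and> stores n m V ow l k s"])
    fix k s assume k: "k < m" and "\<exists>ow l. greedy_inv n m V w ow l k \<and> stores n m V ow l k s"
    then obtain ow l where inv: "greedy_inv n m V w ow l k" and st: "stores n m V ow l k s" by blast
    have "card {g \<in> {1..m}. ow g > 0} = k" using inv unfolding greedy_inv_def by blast
    then have "{g \<in> {1..m}. ow g > 0} \<noteq> {1..m}" using k by auto
    then obtain g0 where g0: "g0 \<in> {1..m}" "ow g0 = 0" by blast
    have "runs greedy_round s (11 * (n * m) + 11 * n + 12)
        (\<lambda>s. \<exists>ow l. greedy_inv n m V w ow l (Suc k) \<and> stores n m V ow l (Suc k) s)"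
    proof (rule runs_mono[OF greedy_round_runs[OF st _ likes g0] order_refl])
      show "m > 0" using k by simp
    next
      fix s' assume "\<exists>a b x. a \<in> {1..n} \<and> V a b > 0 \<and> (\<forall>i\<in>{1..n}. V i b > 0 \<longrightarrow> l a \<le> l i) \<and>
        b \<in> {1..m} \<and> ow b = 0 \<and> (\<exists>i\<in>{1..n}. V i b = x) \<and>
        (\<forall>i\<in>{1..n}. \<forall>g\<in>{1..m}. ow g = 0 \<longrightarrow> V i g \<le> x) \<and>
        stores n m V (ow(b := a)) (l(a := l a + x)) (Suc k) s'"
      then obtain a b x where a: "a \<in> {1..n}" "V a b > 0" "\<forall>i\<in>{1..n}. V i b > 0 \<longrightarrow> l a \<le> l i"
        and b: "b \<in> {1..m}" "ow b = 0" and x: "\<exists>i\<in>{1..n}. V i b = x"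
          "\<forall>i\<in>{1..n}. \<forall>g\<in>{1..m}. ow g = 0 \<longrightarrow> V i g \<le> x"
        and st': "stores n m V (ow(b := a)) (l(a := l a + x)) (Suc k) s'" by blast
      have wx: "w g \<le> x" if "g \<in> {1..m}" "ow g = 0" for g
        using att[OF that(1)] x(2) that by metis
      \<comment> \<open>\<open>x\<close> is an entry of column \<open>b\<close>, hence at most
        \<open>w b\<close>; it bounds all entries of free goods, hence is at least
        \<open>w b\<close>.\<close>
      have "x = w b" using x(1) ub b(1) wx[OF b] by (metis order_antisym)
      then have "greedy_inv n m V w (ow(b := a)) (l(a := l a + x)) (Suc k)"
        using greedy_inv_step[OF inv w0 a(1,2) _ b] a(3) wx by blast
      then show "\<exists>ow l. greedy_inv n m V w ow l (Suc k) \<and> stores n m V ow l (Suc k) s'"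
        using st' by blast
    qed
    moreover have "bval (NLess (ncell ''r'') (ncell ''m'')) s" using st k by (simp add: stores_def)
    ultimately show "bval (NLess (ncell ''r'') (ncell ''m'')) s \<and>
      runs greedy_round s (11 * (n * m) + 11 * n + 12)
        (\<lambda>s. \<exists>ow l. greedy_inv n m V w ow l (Suc k) \<and> stores n m V ow l (Suc k) s)" by blast
  next
    show "\<not> bval (NLess (ncell ''r'') (ncell ''m'')) s"
      if "\<exists>ow l. greedy_inv n m V w ow l m \<and> stores n m V ow l m s" for s
      using that by (auto simp: stores_def)
  next
    show "\<exists>ow l. greedy_inv n m V w ow l 0 \<and> stores n m V ow l 0 s"
      using greedy_inv_initial init by blast
  qed
qed

section \<open>From weights back to valuations\<close>

lemma range_parameter_le:
  assumes inst: "fair_division_instance n m v" and g: "g \<in> {1..m}"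
    and i: "i \<in> {1..n}" "v i {g} > 0"
  shows "range_parameter n m v * Max {v i {g} |i. i \<in> {1..n}} \<le> v i {g}"
proof -
  let ?P = "{v j {g} |j. j \<in> {1..n} \<and> v j {g} > 0}" and ?M = "{v i {g} |i. i \<in> {1..n}}"
  have "v i {g} \<le> Max ?M" using i(1) by (intro Max_ge) auto
  then have pos: "Max ?M > 0" using i(2) by linarith
  \<comment> \<open>Multiplying the ratio for \<open>g\<close> by the largest value leaves the
    smallest positive value, a lower bound for every agent who values \<open>g\<close>.\<close>
  have "range_parameter n m v \<le> good_range n v g"
    unfolding range_parameter_def using g by (intro Min_le) auto
  then have "range_parameter n m v * Max ?M \<le> good_range n v g * Max ?M"
    using pos by (intro mult_right_mono) auto
  also have "\<dots> = Min ?P" using pos unfolding good_range_def by simp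
  also have "\<dots> \<le> v i {g}" using i by (intro Min_le) auto
  finally show ?thesis .
qed

lemma mms2_le:
  assumes "finite S" "\<And>X. X \<subseteq> S \<Longrightarrow> min (u X) (u (S - X)) \<le> c"
  shows "mms2 u S \<le> c"
proof -
  have "{min (u X) (u (S - X)) |X. X \<subseteq> S} = (\<lambda>X. min (u X) (u (S - X))) ` Pow S" by auto
  then show ?thesis unfolding mms2_def using assms by (subst Max_le_iff) auto
qed

text \<open>The factor \<open>range_parameter n m v\<close> is lost only once: it enters the lower
  bound for the own bundle, while the values in the maximin share are bounded above by weights at no
  loss.\<close>

lemma greedy_solves:
  assumes inst: "fair_division_instance n m v"
    and w_def: "w = (\<lambda>g. Max {v i {g} |i. i \<in> {1..n}})"
    and inv: "greedy_inv n m (\<lambda>i g. v i {g}) w ow l m"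
  shows "allocation n m (share m ow)" "PMMS (5 / 6 * range_parameter n m v) n v (share m ow)"
proof -
  let ?V = "\<lambda>i g. v i {g}" and ?\<gamma> = "range_parameter n m v"
  have own: "ow g \<le> n" "ow g > 0 \<Longrightarrow> v (ow g) {g} > 0" if "g \<in> {1..m}" for g
    using inv that unfolding greedy_inv_def by blast+
  have "card {g \<in> {1..m}. ow g > 0} = m" using inv unfolding greedy_inv_def by blast
  then have "{g \<in> {1..m}. ow g > 0} = {1..m}" by (intro card_subset_eq) auto
  then have pos: "ow g > 0" if "g \<in> {1..m}" for g using that by blast
  show "allocation n m (share m ow)"
    unfolding allocation_def disjoint_family_on_def share_def
    using own(1) pos by (fastforce simp: Suc_le_eq)
  have v_sum: "v i S = (\<Sum>g\<in>S. v i {g})" and v0: "v i S \<ge> 0" if "i \<in> {1..n}" "S \<subseteq> {1..m}" for i S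
    using inst that unfolding fair_division_instance_def by blast+
  have le_w: "v i {g} \<le> w g" if "i \<in> {1..n}" for i g
    unfolding w_def using that by (intro Max_ge) auto
  have w_pos: "w g > 0" if "g \<in> {1..m}" for g
    using inst that le_w unfolding fair_division_instance_def by (metis less_le_trans)
  have \<gamma>: "?\<gamma> > 0" using range_parameter_bounds[OF inst] by blast
  show "PMMS (5 / 6 * ?\<gamma>) n v (share m ow)"
    unfolding PMMS_def
  proof (intro ballI impI)
    fix i j assume ij: "i \<in> {1..n}" "j \<in> {1..n}" "i \<noteq> j"
    let ?A = "share m ow i" and ?S = "share m ow i \<union> share m ow j"
    have S: "?S \<subseteq> {1..m}" by (auto simp: share_def)
    have A: "v i {g} > 0" if "g \<in> ?A" for g using that own pos by (auto simp: share_def)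
    have "?\<gamma> * sum w ?A = (\<Sum>g\<in>?A. ?\<gamma> * w g)" by (simp add: sum_distrib_left)
    also have "\<dots> \<le> (\<Sum>g\<in>?A. v i {g})"
      using range_parameter_le[OF inst _ ij(1)] A S unfolding w_def by (intro sum_mono) blast
    also have "\<dots> = v i ?A" using v_sum ij(1) S by simp
    finally have low: "?\<gamma> * sum w ?A \<le> v i ?A" .
    \<comment> \<open>Goods that \<open>i\<close> does not value contribute 0 and are dropped before
      passing to weights, as their weight is positive.\<close>
    have up: "v i X \<le> sum w (liked ?V i X)" if "X \<subseteq> ?S" for X
    proof -
      have X: "X \<subseteq> {1..m}" "finite X" using that S by (auto intro: finite_subset)
      have "v i X = (\<Sum>g\<in>X. v i {g})" using v_sum ij(1) X by blast
      also have "\<dots> = (\<Sum>g\<in>liked ?V i X. v i {g})"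
        using X v0[OF ij(1), of "{_}"] by (intro sum.mono_neutral_right) (force simp: liked_def)+
      also have "\<dots> \<le> sum w (liked ?V i X)" using le_w[OF ij(1)] by (intro sum_mono)
      finally show ?thesis .
    qed
    have "mms2 (v i) ?S \<le> 6 / 5 * sum w ?A"
    proof (rule mms2_le)
      fix X assume X: "X \<subseteq> ?S"
      let ?X = "liked ?V i X" and ?Y = "liked ?V i (?S - X)"
      \<comment> \<open>\<open>i\<close> values all its own goods, so restricting to liked goods
        leaves its bundle intact.\<close>
      have "?X \<union> ?Y = ?A \<union> liked ?V i (share m ow j)" "?X \<inter> ?Y = {}"
        using X A by (auto simp: liked_def)
      then have "5 / 6 * min (sum w ?X) (sum w ?Y) \<le> sum w ?A"
        using greedy_pair[OF inv w_pos ij] by blast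
      moreover have "min (v i X) (v i (?S - X)) \<le> min (sum w ?X) (sum w ?Y)"
        using up[OF X] up[of "?S - X"] by (intro min.mono) auto
      ultimately show "min (v i X) (v i (?S - X)) \<le> 6 / 5 * sum w ?A" by linarith
    qed simp
    then have "5 / 6 * ?\<gamma> * mms2 (v i) ?S \<le> 5 / 6 * ?\<gamma> * (6 / 5 * sum w ?A)"
      using \<gamma> by (intro mult_left_mono) auto
    also have "\<dots> = ?\<gamma> * sum w ?A" by simp
    finally show "5 / 6 * ?\<gamma> * mms2 (v i) ?S \<le> v i ?A" using low by linarith
  qed
qed

theorem theorem4:
  "poly_time_computable
     (\<lambda>n m v. fair_division_instance n m v \<and>
        0 < range_parameter n m v \<and> range_parameter n m v \<le> 1)
     (\<lambda>n m v A. allocation n m A \<and> PMMS (5 / 6 * range_parameter n m v) n v A)"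
  unfolding poly_time_computable_def
proof (intro exI[of _ greedy] exI[of _ "monom 36 2"] allI impI)
  fix n m :: nat and v :: "nat \<Rightarrow> nat set \<Rightarrow> real"
  assume "fair_division_instance n m v \<and> 0 < range_parameter n m v \<and> range_parameter n m v \<le> 1"
  then have inst: "fair_division_instance n m v" by blast
  then have n: "n \<ge> 1" and likes: "\<And>g. g \<in> {1..m} \<Longrightarrow> \<exists>i\<in>{1..n}. v i {g} > 0"
    and "\<forall>i\<in>{1..n}. \<exists>g\<in>{1..m}. v i {g} > 0"
    unfolding fair_division_instance_def by blast+
  then have "\<exists>g. g \<in> {1..m}" using n by (meson atLeastAtMost_iff order_refl)
  then have m: "m \<ge> 1" by auto
  define w where "w = (\<lambda>g. Max {v i {g} |i. i \<in> {1..n}})"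
  have "runs greedy (input_state n m v) (m * Suc (11 * (n * m) + 11 * n + 12) + 1)
    (\<lambda>s. \<exists>ow l. greedy_inv n m (\<lambda>i g. v i {g}) w ow l m \<and> stores n m (\<lambda>i g. v i {g}) ow l m s)"
  proof (rule greedy_runs[OF _ likes])
    show "stores n m (\<lambda>i g. v i {g}) (\<lambda>_. 0) (\<lambda>_. 0) 0 (input_state n m v)"
      by (simp add: stores_def input_state_def)
    show "v i {g} \<le> w g" if "i \<in> {1..n}" for i g
      unfolding w_def using that by (intro Max_ge) auto
    show "\<exists>i\<in>{1..n}. v i {g} = w g" for g
    proof -
      have "w g \<in> {v i {g} |i. i \<in> {1..n}}" unfolding w_def using n by (intro Max_in) auto
      then show ?thesis by auto
    qed
  qed
  then obtain t s ow l where ex: "exec greedy (input_state n m v) t s"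
    and t: "t \<le> m * Suc (11 * (n * m) + 11 * n + 12) + 1"
    and inv: "greedy_inv n m (\<lambda>i g. v i {g}) w ow l m"
    and st: "stores n m (\<lambda>i g. v i {g}) ow l m s" unfolding runs_def by blast
  let ?N = "input_size n m"
  have "n \<le> n * m" "m \<le> n * m" using n m by simp_all
  then have nm: "n \<le> ?N" "m \<le> ?N" "n * m \<le> ?N" "1 \<le> ?N" unfolding input_size_def by linarith+
  \<comment> \<open>The sum \<open>11 + 11 + 13\<close> gives 35; the failing test of the outer loop
    accounts for the 36 in the polynomial.\<close>
  have "Suc (11 * (n * m) + 11 * n + 12) \<le> 35 * ?N" using nm by linarith
  then have "m * Suc (11 * (n * m) + 11 * n + 12) \<le> ?N * (35 * ?N)"
    using nm(2) by (intro mult_mono) auto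
  moreover have "1 \<le> ?N * ?N" using nm(4) by simp
  ultimately have "t \<le> 36 * (?N * ?N)" using t by linarith
  then have "t \<le> poly (monom 36 2) ?N" by (simp add: poly_monom power2_eq_square)
  moreover have "output_allocation m s = share m ow"
    using st by (auto simp: output_allocation_def share_def stores_def)
  ultimately show "\<exists>t s. exec greedy (input_state n m v) t s \<and> t \<le> poly (monom 36 2) ?N \<and>
      allocation n m (output_allocation m s) \<and>
      PMMS (5 / 6 * range_parameter n m v) n v (output_allocation m s)"
    using ex greedy_solves[OF inst w_def inv] by metis
qed

end
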